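(* Let $\prod_{i=1}^{\infty}a_i$ be a convergent infinite product of complex numbers with $a_i\neq 0$ for $i\geq 1$, and let $\{b_n\}_{n=0}^{\infty}$ be any sequence of complex numbers whose limit is $1$ and such that $a_ib_i-b_{i-1}\neq 0$ for all $i\geq 1$. Then $$\prod_{i=1}^{\infty}a_i=b_0+\mathop{K}_{n=1}^{\infty}\frac{p_n}{q_n},$$ where $$p_1=a_1b_1-b_0,\qquad q_1=1,$$ $$p_2=-a_1(a_2b_2-b_1),\qquad q_2=a_2a_1b_2-b_0,$$ and, for $n\geq 3$, $$p_n=-a_{n-1}(a_{n-2}b_{n-2}-b_{n-3})(a_nb_n-b_{n-1}),\qquad q_n=a_na_{n-1}b_n-b_{n-2}.$$ (In particular, the continued fraction converges.)
   Context: For sequences $\{p_n\}_{n\ge1}$, $\{q_n\}_{n\ge1}$ of complex numbers, the continued fraction $\mathop{K}_{n=1}^{\infty} p_n/q_n$ is $$\cfrac{p_1}{q_1+\cfrac{p_2}{q_2+\cfrac{p_3}{q_3+\cdots}}}.$$ Its $N$-th approximant is $A_N/B_N$, where $A_N=q_NA_{N-1}+p_NA_{N-2}$ and $B_N=q_NB_{N-1}+p_NB_{N-2}$ for $N\ge 1$, with $A_{-1}=1$, $A_0=0$, $B_{-1}=0$, $B_0=1$. The symbol $\mathop{K}_{n=1}^{\infty} p_n/q_n$ also denotes the limit $\lim_{N\to\infty}A_N/B_N$ when it exists, in which case the continued fraction is said to converge. *)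

theory Defs
  imports "HOL-Analysis.Analysis"
begin

text \<open>The three-term recurrence \<open>X\<^sub>N = q\<^sub>N X\<^sub>N\<^sub>-\<^sub>1 + p\<^sub>N X\<^sub>N\<^sub>-\<^sub>2\<close> for \<open>N \<ge> 1\<close>, where \<open>u\<close> and \<open>v\<close>
  are the initial values at the indices \<open>-1\<close> and \<open>0\<close>. The values \<open>p 0\<close> and \<open>q 0\<close> are never used.\<close>

fun cf_rec :: "(nat \<Rightarrow> complex) \<Rightarrow> (nat \<Rightarrow> complex) \<Rightarrow> complex \<Rightarrow> complex \<Rightarrow> nat \<Rightarrow> complex" where
  "cf_rec p q u v 0 = v"
| "cf_rec p q u v (Suc 0) = q 1 * v + p 1 * u"
| "cf_rec p q u v (Suc (Suc n)) =
     q (Suc (Suc n)) * cf_rec p q u v (Suc n) + p (Suc (Suc n)) * cf_rec p q u v n"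

definition cf_num :: "(nat \<Rightarrow> complex) \<Rightarrow> (nat \<Rightarrow> complex) \<Rightarrow> nat \<Rightarrow> complex" where
  "cf_num p q = cf_rec p q 1 0"

definition cf_den :: "(nat \<Rightarrow> complex) \<Rightarrow> (nat \<Rightarrow> complex) \<Rightarrow> nat \<Rightarrow> complex" where
  "cf_den p q = cf_rec p q 0 1"

text \<open>Since \<open>x / 0 = 0\<close> in HOL, convergence explicitly requires the approximants to be defined
  from some index on.\<close>

definition has_cf_value :: "(nat \<Rightarrow> complex) \<Rightarrow> (nat \<Rightarrow> complex) \<Rightarrow> complex \<Rightarrow> bool" where
  "has_cf_value p q L \<longleftrightarrow>
     (\<forall>\<^sub>F N in sequentially. cf_den p q N \<noteq> 0) \<and> (\<lambda>N. cf_num p q N / cf_den p q N) \<longlonglongrightarrow> L"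

definition cf_convergent :: "(nat \<Rightarrow> complex) \<Rightarrow> (nat \<Rightarrow> complex) \<Rightarrow> bool" where
  "cf_convergent p q \<longleftrightarrow> (\<exists>L. has_cf_value p q L)"

definition cf_value :: "(nat \<Rightarrow> complex) \<Rightarrow> (nat \<Rightarrow> complex) \<Rightarrow> complex" where
  "cf_value p q = (THE L. has_cf_value p q L)"

end

theory Submission
  imports Defs
begin

text \<open>
  Write \<open>d n = a n * b n - b (n - 1)\<close> and \<open>P n = a 1 * \<dots> * a n\<close>. Since
  \<open>P n * b n - P (n - 1) * b (n - 1) = P (n - 1) * d n\<close>, the quantity \<open>P n * b n - b 0\<close> is the
  partial sum of the series with terms \<open>P (n - 1) * d n\<close>; as \<open>b\<close> tends to \<open>1\<close>, the sum of the series
  is the infinite product minus \<open>b 0\<close>. The ratio of consecutive terms is \<open>a n * d (n + 1) / d n\<close>,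
  and the continued fraction is the one that Euler's transformation attaches to such a series, with
  denominators cleared. Its approximants are exactly the partial sums
  (\<open>cf_den_euler\<close>, \<open>cf_num_euler\<close>).

  What makes this work is that \<open>q n = d (n - 1) + a (n - 1) * d n\<close>, so that the three-term
  recurrence factors: for \<open>n \<ge> 3\<close> every solution satisfies
  \<open>X n - d (n - 1) * X (n - 1) = a (n - 1) * d n * (X (n - 1) - d (n - 2) * X (n - 2))\<close>.
  The denominators are the solution for which both sides vanish, namely \<open>d 1 * \<dots> * d (n - 1)\<close>,
  which is nonzero by hypothesis. For the numerators, the factored recurrence says that, after
  division by the denominators, consecutive values differ by the next term of the series.
\<close>

text \<open>
  One factor of the recurrence is \<open>X (n + 1) = d n * X n\<close>, and the initial values \<open>B 1 = 1\<close>,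
  \<open>B 2 = d 1\<close> select its solution. Because \<open>B 0 = 1\<close> as well, the product formula only begins at
  index \<open>1\<close>.
\<close>

lemma cf_den_euler:
  fixes a d p q :: "nat \<Rightarrow> complex"
  assumes "q 1 = 1" and p2: "p 2 = - a 1 * d 2"
    and q: "\<And>n. q (n + 2) = d (n + 1) + a (n + 1) * d (n + 2)"
    and p: "\<And>n. p (n + 3) = - a (n + 2) * d (n + 1) * d (n + 3)"
  shows "cf_den p q (Suc n) = (\<Prod>i<n. d (Suc i))"
proof (induction n rule: induct_nat_012)
  case 0
  show ?case using assms(1) by (simp add: cf_den_def)
next
  case 1
  show ?case using assms(1) p2 q[of 0] by (simp add: cf_den_def numeral_2_eq_2)
next
  case (ge2 n)
  have "cf_den p q (Suc (Suc (Suc n)))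
      = q (n + 3) * cf_den p q (Suc (Suc n)) + p (n + 3) * cf_den p q (Suc n)"
    by (simp add: cf_den_def numeral_3_eq_3)
  also have "\<dots> = (d (n + 2) + a (n + 2) * d (n + 3)) * cf_den p q (Suc (Suc n))
      - a (n + 2) * d (n + 3) * (d (n + 1) * cf_den p q (Suc n))"
    using q[of "Suc n"] p[of n] by (simp add: eval_nat_numeral algebra_simps)
  also have "d (n + 1) * cf_den p q (Suc n) = cf_den p q (Suc (Suc n))"
    unfolding ge2.IH by simp
  finally show ?case
    unfolding ge2.IH(2) by (simp add: algebra_simps)
qed

text \<open>
  Substituting \<open>X n = B n * S n\<close> in the factored recurrence, where \<open>B n\<close> are the denominators,
  turns it into \<open>S (n + 1) - S n = a n * d (n + 1) / d n * (S n - S (n - 1))\<close>. So the increments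
  of \<open>S\<close> are the terms of a series with ratios \<open>a n * d (n + 1) / d n\<close>, starting with \<open>d 1\<close>.
\<close>

lemma cf_num_euler:
  fixes a d p q :: "nat \<Rightarrow> complex"
  assumes "p 1 = d 1"
    and q: "\<And>n. q (n + 2) = d (n + 1) + a (n + 1) * d (n + 2)"
    and p: "\<And>n. p (n + 3) = - a (n + 2) * d (n + 1) * d (n + 3)"
  shows "cf_num p q (Suc n) =
    (\<Prod>i<n. d (Suc i)) * (\<Sum>k\<le>n. (\<Prod>i<k. a (Suc i)) * d (Suc k))"
proof (induction n rule: induct_nat_012)
  case 0
  show ?case using assms(1) by (simp add: cf_num_def)
next
  case 1
  show ?case using assms(1) q[of 0] by (simp add: cf_num_def numeral_2_eq_2 algebra_simps)
next
  case (ge2 n)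
  define B where "B = (\<Prod>i<n. d (Suc i))"
  define P where "P = (\<Prod>i<n. a (Suc i))"
  define S where "S = (\<Sum>k\<le>n. (\<Prod>i<k. a (Suc i)) * d (Suc k))"
  define S' where "S' = S + P * a (n + 1) * d (n + 2)"
  have "cf_num p q (Suc (Suc (Suc n)))
      = q (n + 3) * cf_num p q (Suc (Suc n)) + p (n + 3) * cf_num p q (Suc n)"
    by (simp add: cf_num_def numeral_3_eq_3)
  also have "\<dots> = (d (n + 2) + a (n + 2) * d (n + 3)) * (B * d (n + 1) * S')
      - a (n + 2) * d (n + 1) * d (n + 3) * (B * S)"
    using ge2.IH q[of "Suc n"] p[of n]
    by (simp add: B_def S_def S'_def P_def eval_nat_numeral)
  also have "\<dots> = B * d (n + 1) * d (n + 2) * (S' + P * a (n + 1) * a (n + 2) * d (n + 3))"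
    by (simp add: S'_def algebra_simps)
  also have "\<dots> = (\<Prod>i<Suc (Suc n). d (Suc i)) *
      (\<Sum>k\<le>Suc (Suc n). (\<Prod>i<k. a (Suc i)) * d (Suc k))"
    by (simp add: B_def S_def S'_def P_def eval_nat_numeral)
  finally show ?case .
qed

lemma sum_partial_prod_telescope:
  fixes a b :: "nat \<Rightarrow> 'a::comm_ring_1"
  shows "(\<Sum>k\<le>n. (\<Prod>i<k. a (Suc i)) * (a (Suc k) * b (Suc k) - b k))
    = (\<Prod>i\<le>n. a (Suc i)) * b (Suc n) - b 0"
  by (induction n) (simp_all add: algebra_simps flip: lessThan_Suc_atMost)

lemma has_cf_value_unique:
  assumes "has_cf_value p q L" and "has_cf_value p q M"
  shows "L = M"
  using assms LIMSEQ_unique unfolding has_cf_value_def by blast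

theorem proposition4:
  fixes a b p q :: "nat \<Rightarrow> complex"
  assumes "convergent_prod (\<lambda>i. a (Suc i))"
    and "\<And>i. i \<ge> 1 \<Longrightarrow> a i \<noteq> 0"
    and "b \<longlonglongrightarrow> 1"
    and "\<And>i. i \<ge> 1 \<Longrightarrow> a i * b i - b (i - 1) \<noteq> 0"
    and "p 1 = a 1 * b 1 - b 0" and "q 1 = 1"
    and "p 2 = - a 1 * (a 2 * b 2 - b 1)" and "q 2 = a 2 * a 1 * b 2 - b 0"
    and "\<And>n. n \<ge> 3 \<Longrightarrow>
           p n = - a (n - 1) * (a (n - 2) * b (n - 2) - b (n - 3)) * (a n * b n - b (n - 1))"
    and "\<And>n. n \<ge> 3 \<Longrightarrow> q n = a n * a (n - 1) * b n - b (n - 2)"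
  shows "cf_convergent p q \<and> (\<Prod>i. a (Suc i)) = b 0 + cf_value p q"
proof -
  define d where "d n = a n * b n - b (n - 1)" for n
  have init: "p 1 = d 1" "q 1 = 1" "p 2 = - a 1 * d 2"
    using assms(5-7) by (simp_all add: d_def)
  have q: "q (n + 2) = d (n + 1) + a (n + 1) * d (n + 2)" for n
    using assms(8) assms(10)[of "n + 2"]
    by (cases n) (simp_all add: d_def eval_nat_numeral algebra_simps)
  have p: "p (n + 3) = - a (n + 2) * d (n + 1) * d (n + 3)" for n
    using assms(9)[of "n + 3"] by (simp add: d_def eval_nat_numeral)
  have den_nz: "cf_den p q (Suc n) \<noteq> 0" for n
  proof -
    have "d (Suc i) \<noteq> 0" for i
      using assms(4)[of "Suc i"] by (simp add: d_def)
    then show ?thesis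
      by (simp add: cf_den_euler[where a = a and d = d, OF init(2,3) q p])
  qed
  have approximant: "cf_num p q (Suc n) / cf_den p q (Suc n)
      = (\<Prod>i\<le>n. a (Suc i)) * b (Suc n) - b 0" for n
  proof -
    have "cf_num p q (Suc n)
        = cf_den p q (Suc n) * (\<Sum>k\<le>n. (\<Prod>i<k. a (Suc i)) * d (Suc k))"
      by (simp only: cf_num_euler[where a = a and d = d, OF init(1) q p]
          cf_den_euler[where a = a and d = d, OF init(2,3) q p])
    also have "(\<Sum>k\<le>n. (\<Prod>i<k. a (Suc i)) * d (Suc k))
        = (\<Prod>i\<le>n. a (Suc i)) * b (Suc n) - b 0"
      by (simp add: d_def sum_partial_prod_telescope)
    finally show ?thesis using den_nz by simp
  qed
  have "(\<lambda>n. (\<Prod>i\<le>n. a (Suc i)) * b (Suc n) - b 0)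
      \<longlonglongrightarrow> (\<Prod>i. a (Suc i)) * 1 - b 0"
    by (intro tendsto_intros convergent_prod_LIMSEQ assms(1) LIMSEQ_Suc assms(3))
  then have "(\<lambda>n. cf_num p q (Suc n) / cf_den p q (Suc n)) \<longlonglongrightarrow> (\<Prod>i. a (Suc i)) - b 0"
    by (simp add: approximant)
  then have lim: "(\<lambda>n. cf_num p q n / cf_den p q n) \<longlonglongrightarrow> (\<Prod>i. a (Suc i)) - b 0"
    by (rule LIMSEQ_imp_Suc)
  have "\<forall>\<^sub>F n in sequentially. cf_den p q n \<noteq> 0"
    using den_nz by (subst eventually_sequentially_Suc[symmetric]) simp
  with lim have val: "has_cf_value p q ((\<Prod>i. a (Suc i)) - b 0)"
    by (simp add: has_cf_value_def)
  then have "cf_value p q = (\<Prod>i. a (Suc i)) - b 0"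
    unfolding cf_value_def by (blast intro: has_cf_value_unique)
  with val show ?thesis
    by (auto simp: cf_convergent_def)
qed

end
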